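(* Let $\mathbb{F}$ be $\mathbb{R}$ or $\mathbb{C}$, let $(\mathfrak{d},\Omega)$ be any symmetric self-dual Lie algebra over $\mathbb{F}$ with Killing form $\kappa$, let $t\in\mathbb{F}$, put $g_t=\Omega-t\kappa$, and let $\mathfrak{d}^\perp=\{v\in\mathfrak{d} : g_t(v,w)=0 \text{ for all } w\in\mathfrak{d}\}$ be the radical of $g_t$ (an ideal of $\mathfrak{d}$). Then: (1) $\mathfrak{d}^\perp$ is semisimple; (2) $\mathfrak{d}$ decomposes into an orthogonal direct product of ideals $\mathfrak{d}=\mathfrak{d}^\perp\times\mathfrak{d}_1$, where $\mathfrak{d}^\perp$ is semisimple and $\mathfrak{d}_1^\perp=0$.
   Context: A symmetric self-dual Lie algebra is a pair $(\mathfrak{d},\Omega)$ where $\mathfrak{d}$ is a finite-dimensional Lie algebra and $\Omega$ is a nondegenerate symmetric ad-invariant bilinear form on $\mathfrak{d}$, i.e. $\Omega([x,y],z)=\Omega(x,[y,z])$ for all $x,y,z$. Orthogonality of the direct product is with respect to $\Omega$. In (2), $\mathfrak{d}_1^\perp$ denotes the radical, in $\mathfrak{d}_1$, of the bilinear form $\Omega|_{\mathfrak{d}_1}-t\kappa_{\mathfrak{d}_1}$, where $\kappa_{\mathfrak{d}_1}$ is the Killing form of $\mathfrak{d}_1$, for the same scalar $t$. The zero Lie algebra is counted as semisimple. *)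

theory Defs
  imports Complex_Main
begin

locale lie_algebra = vector_space scale
  for scale :: "'k::field \<Rightarrow> 'v::ab_group_add \<Rightarrow> 'v" +
  fixes brk :: "'v \<Rightarrow> 'v \<Rightarrow> 'v"
  assumes brk_linear_left: "Vector_Spaces.linear scale scale (\<lambda>x. brk x y)"
    and brk_linear_right: "Vector_Spaces.linear scale scale (brk x)"
    and brk_self: "brk x x = 0"
    and jacobi: "brk x (brk y z) + brk y (brk z x) + brk z (brk x y) = 0"
begin

text \<open>
  Trace of the endomorphism of the finite-dimensional subspace \<open>S\<close> induced by a map \<open>f\<close> that
  leaves \<open>S\<close> invariant and is linear on \<open>S\<close>. The chosen basis is irrelevant by \<open>trace_on_eq\<close>.
\<close>

definition trace_on :: "'v set \<Rightarrow> ('v \<Rightarrow> 'v) \<Rightarrow> 'k" where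
  "trace_on S f =
     (let B = (SOME B. B \<subseteq> S \<and> independent B \<and> span B = S)
      in \<Sum>b\<in>B. representation B (f b) b)"

lemma basis_trace_eq:
  assumes B: "independent B" "finite B" and C: "independent C" "finite C"
    and BC: "span C = span B"
    and inv: "\<And>x. x \<in> span B \<Longrightarrow> f x \<in> span B"
    and add: "\<And>x y. x \<in> span B \<Longrightarrow> y \<in> span B \<Longrightarrow> f (x + y) = f x + f y"
    and scl: "\<And>c x. x \<in> span B \<Longrightarrow> f (scale c x) = scale c (f x)"
  shows "(\<Sum>b\<in>B. representation B (f b) b) = (\<Sum>c\<in>C. representation C (f c) c)"
proof -
  have inB: "b \<in> span B" if "b \<in> B" for b using that by (rule span_base)
  have inC: "c \<in> span B" if "c \<in> C" for c using that BC span_base by blast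
  have f0: "f 0 = 0" using scl[of 0 0] by (simp add: span_zero)
  have fsum: "f (\<Sum>i\<in>I. scale (r i) i) = (\<Sum>i\<in>I. scale (r i) (f i))"
    if "finite I" "I \<subseteq> span B" for I r
    using that
  proof (induction I rule: finite_induct)
    case empty then show ?case by (simp add: f0)
  next
    case (insert x F)
    then have "(\<Sum>i\<in>F. scale (r i) i) \<in> span B"
      by (intro span_sum span_scale) auto
    with insert show ?case by (simp add: add scl span_scale)
  qed
  have repC: "f b = (\<Sum>c\<in>C. scale (representation C (f b) c) c)" if "b \<in> B" for b
    using sum_representation_eq[of C "f b" C] C BC inv inB that by simp
  have repB: "c = (\<Sum>b\<in>B. scale (representation B c b) b)" if "c \<in> C" for c
    using sum_representation_eq[of B c B] B inC that by simp
  have "(\<Sum>b\<in>B. representation B (f b) b) =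
      (\<Sum>b\<in>B. \<Sum>c\<in>C. representation C (f b) c * representation B c b)"
  proof (rule sum.cong[OF refl])
    fix b assume b: "b \<in> B"
    have "representation B (f b) = representation B (\<Sum>c\<in>C. scale (representation C (f b) c) c)"
      using repC[OF b] by simp
    also have "\<dots> = (\<lambda>b'. \<Sum>c\<in>C. representation C (f b) c * representation B c b')"
      using B(1) inC by (simp add: representation_sum representation_scale span_scale)
    finally show "representation B (f b) b =
        (\<Sum>c\<in>C. representation C (f b) c * representation B c b)"
      by simp
  qed
  also have "\<dots> = (\<Sum>c\<in>C. \<Sum>b\<in>B. representation B c b * representation C (f b) c)"
    by (subst sum.swap) (simp add: mult.commute)
  also have "\<dots> = (\<Sum>c\<in>C. representation C (f c) c)"
  proof (rule sum.cong[OF refl])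
    fix c assume c: "c \<in> C"
    have "f c = f (\<Sum>b\<in>B. scale (representation B c b) b)" using repB[OF c] by simp
    also have "\<dots> = (\<Sum>b\<in>B. scale (representation B c b) (f b))"
      using B inB by (intro fsum) auto
    finally have "representation C (f c) =
        representation C (\<Sum>b\<in>B. scale (representation B c b) (f b))" by simp
    also have "\<dots> = (\<lambda>c'. \<Sum>b\<in>B. representation B c b * representation C (f b) c')"
      using C(1) inB inv BC by (simp add: representation_sum representation_scale span_scale)
    finally show "(\<Sum>b\<in>B. representation B c b * representation C (f b) c) =
        representation C (f c) c" by simp
  qed
  finally show ?thesis .
qed

lemma trace_on_eq:
  assumes C: "independent C" "finite C" "span C = S"
    and "\<And>x. x \<in> S \<Longrightarrow> f x \<in> S"
    and "\<And>x y. x \<in> S \<Longrightarrow> y \<in> S \<Longrightarrow> f (x + y) = f x + f y"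
    and "\<And>c x. x \<in> S \<Longrightarrow> f (scale c x) = scale c (f x)"
  shows "trace_on S f = (\<Sum>c\<in>C. representation C (f c) c)"
proof -
  define B where "B = (SOME B. B \<subseteq> S \<and> independent B \<and> span B = S)"
  have "C \<subseteq> S \<and> independent C \<and> span C = S"
    using C span_superset by auto
  then have B: "B \<subseteq> S \<and> independent B \<and> span B = S"
    unfolding B_def by (rule someI)
  have "finite B"
    using independent_span_bound[of C B] B C by auto
  with B C assms(4-) show ?thesis
    unfolding trace_on_def B_def[symmetric] Let_def
    by (intro basis_trace_eq) auto
qed

text \<open>
  The notions below are relative to the carrier \<open>S\<close> of a Lie subalgebra, regarded as a Lie algebra
  in its own right; \<open>S = UNIV\<close> gives the notions for the whole algebra.
\<close>

definition lie_ideal :: "'v set \<Rightarrow> 'v set \<Rightarrow> bool" where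
  "lie_ideal I S \<longleftrightarrow> I \<subseteq> S \<and> subspace I \<and> (\<forall>x\<in>S. \<forall>y\<in>I. brk x y \<in> I)"

primrec derived_series :: "'v set \<Rightarrow> nat \<Rightarrow> 'v set" where
  "derived_series S 0 = S"
| "derived_series S (Suc n) =
     span {brk x y | x y. x \<in> derived_series S n \<and> y \<in> derived_series S n}"

definition solvable :: "'v set \<Rightarrow> bool" where
  "solvable S \<longleftrightarrow> (\<exists>n. derived_series S n = {0})"

text \<open>Vanishing solvable radical; in particular \<open>{0}\<close> is semisimple.\<close>

definition semisimple :: "'v set \<Rightarrow> bool" where
  "semisimple S \<longleftrightarrow> (\<forall>I. lie_ideal I S \<and> solvable I \<longrightarrow> I = {0})"

definition killing :: "'v set \<Rightarrow> 'v \<Rightarrow> 'v \<Rightarrow> 'k" where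
  "killing S x y = trace_on S (\<lambda>z. brk x (brk y z))"

text \<open>
  Internal direct product; the two factors commute, since \<open>brk x y \<in> I \<inter> J\<close> for \<open>x \<in> I\<close>, \<open>y \<in> J\<close>.
\<close>

definition direct_product_of_ideals :: "'v set \<Rightarrow> 'v set \<Rightarrow> bool" where
  "direct_product_of_ideals I J \<longleftrightarrow>
     lie_ideal I UNIV \<and> lie_ideal J UNIV \<and> I \<inter> J = {0} \<and>
     (\<forall>v. \<exists>x\<in>I. \<exists>y\<in>J. v = x + y)"

end

locale self_dual_lie_algebra = lie_algebra scale brk
  for scale :: "'k::field \<Rightarrow> 'v::ab_group_add \<Rightarrow> 'v" and brk +
  fixes \<Omega> :: "'v \<Rightarrow> 'v \<Rightarrow> 'k"
  assumes finite_dimensional: "\<exists>B. finite B \<and> span B = UNIV"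
    and form_linear_left: "Vector_Spaces.linear scale (*) (\<lambda>x. \<Omega> x y)"
    and form_linear_right: "Vector_Spaces.linear scale (*) (\<Omega> x)"
    and form_sym: "\<Omega> x y = \<Omega> y x"
    and form_nondegenerate: "(\<forall>y. \<Omega> x y = 0) \<Longrightarrow> x = 0"
    and form_invariant: "\<Omega> (brk x y) z = \<Omega> x (brk y z)"
begin

text \<open>
  The form \<open>g\<^sub>t = \<Omega> - t \<kappa>\<close> of the subalgebra \<open>S\<close>, with \<open>\<kappa>\<close> the intrinsic Killing form of \<open>S\<close>,
  and its radical in \<open>S\<close>.
\<close>

definition shifted_form :: "'k \<Rightarrow> 'v set \<Rightarrow> 'v \<Rightarrow> 'v \<Rightarrow> 'k" where
  "shifted_form t S x y = \<Omega> x y - t * killing S x y"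

definition shifted_radical :: "'k \<Rightarrow> 'v set \<Rightarrow> 'v set" where
  "shifted_radical t S = {v \<in> S. \<forall>w\<in>S. shifted_form t S v w = 0}"

definition orthogonal :: "'v set \<Rightarrow> 'v set \<Rightarrow> bool" where
  "orthogonal I J \<longleftrightarrow> (\<forall>x\<in>I. \<forall>y\<in>J. \<Omega> x y = 0)"

end

end

theory Submission
  imports Defs
begin

text \<open>
  Write \<open>P\<close> for the radical of \<open>g\<^sub>t\<close> and \<open>P\<^sup>\<bottom>\<close> for its \<open>\<Omega>\<close>-orthogonal complement, so that
  \<open>\<Omega> = t \<kappa>\<close> on \<open>P \<times> \<dd>\<close>. If \<open>A\<close> is an abelian ideal of a Lie algebra \<open>S\<close>, then \<open>ad v \<circ> ad w\<close> squares
  to zero for \<open>v \<in> A\<close> and \<open>w \<in> S\<close>, so \<open>A\<close> lies in the radical of the Killing form of \<open>S\<close>.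
  Hence an abelian ideal of \<open>\<dd>\<close> inside \<open>P\<close> is \<open>\<Omega>\<close>-orthogonal to everything and vanishes.
  By invariance \<open>P\<close> and \<open>P\<^sup>\<bottom>\<close> commute, so \<open>P \<inter> P\<^sup>\<bottom>\<close> is such an ideal: \<open>\<dd> = P \<times> P\<^sup>\<bottom>\<close>.
  An abelian ideal of \<open>P\<close> lies in \<open>P \<inter> P\<^sup>\<bottom>\<close> for the same reason, so \<open>P\<close> is semisimple; and as \<open>P\<close>
  and \<open>P\<^sup>\<bottom>\<close> are orthogonal for \<open>\<kappa>\<close> too, the radical of \<open>g\<^sub>t\<close> on \<open>P\<^sup>\<bottom>\<close> lies in \<open>P \<inter> P\<^sup>\<bottom>\<close>.
\<close>

context lie_algebra
begin

section \<open>Bracket calculus, ideals and the derived series\<close>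

lemma brk_add_left: "brk (x + y) z = brk x z + brk y z"
  using brk_linear_left[of z] by (simp add: Vector_Spaces.linear_iff)

lemma brk_add_right: "brk x (y + z) = brk x y + brk x z"
  using brk_linear_right[of x] by (simp add: Vector_Spaces.linear_iff)

lemma brk_scale_left: "brk (scale c x) y = scale c (brk x y)"
  using brk_linear_left[of y] by (simp add: Vector_Spaces.linear_iff)

lemma brk_scale_right: "brk x (scale c y) = scale c (brk x y)"
  using brk_linear_right[of x] by (simp add: Vector_Spaces.linear_iff)

lemma brk_zero_left: "brk 0 x = 0"
  using brk_add_left[of 0 0 x] by simp

lemma brk_zero_right: "brk x 0 = 0"
  using brk_add_right[of x 0 0] by simp

lemma brk_anticomm: "brk x y = - brk y x"
  using brk_self[of "x + y"] brk_self[of x] brk_self[of y]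
  by (simp add: brk_add_left brk_add_right eq_neg_iff_add_eq_0 add.commute)

lemma brk_minus_right: "brk x (- y) = - brk x y"
  using brk_add_right[of x y "- y"] by (simp add: brk_zero_right eq_neg_iff_add_eq_0 add.commute)

lemma brk_leibniz: "brk x (brk y z) = brk (brk x y) z + brk y (brk x z)"
proof -
  have "brk x (brk y z) - brk y (brk x z) - brk (brk x y) z = 0"
    using jacobi[of x y z] brk_anticomm[of z x] brk_anticomm[of z "brk x y"]
    by (simp add: brk_minus_right)
  then show ?thesis by (simp add: algebra_simps)
qed

lemma lie_idealD:
  assumes "lie_ideal I S"
  shows "I \<subseteq> S" "subspace I" "\<And>x y. x \<in> S \<Longrightarrow> y \<in> I \<Longrightarrow> brk x y \<in> I"
  using assms by (auto simp: lie_ideal_def)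

lemma lie_ideal_brk_left:
  assumes "lie_ideal I S" "x \<in> I" "y \<in> S"
  shows "brk x y \<in> I"
  using lie_idealD(3)[OF assms(1,3,2)] subspace_neg[OF lie_idealD(2)[OF assms(1)]]
  by (subst brk_anticomm) blast

lemma lie_ideal_Int: "lie_ideal I S \<Longrightarrow> lie_ideal J S \<Longrightarrow> lie_ideal (I \<inter> J) S"
  by (auto simp: lie_ideal_def subspace_inter)

text \<open>By the Leibniz form of the Jacobi identity, the adjoint action of \<open>s\<close> sends
  a generator \<open>brk x y\<close> to a sum of two generators, since \<open>brk s x\<close> and
  \<open>brk s y\<close> stay in \<open>I\<close>.\<close>

lemma lie_ideal_span_brk:
  assumes I: "lie_ideal I S"
  shows "lie_ideal (span {brk x y | x y. x \<in> I \<and> y \<in> I}) S" (is "lie_ideal (span ?G) S")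
proof -
  have "?G \<subseteq> I" using lie_idealD[OF I] by auto
  then have "span ?G \<subseteq> S"
    using span_minimal[of ?G I] lie_idealD[OF I] by blast
  moreover have "brk s z \<in> span ?G" if s: "s \<in> S" and z: "z \<in> span ?G" for s z
    using z
  proof (induction z rule: span_induct_alt)
    case base
    show ?case by (simp add: brk_zero_right span_zero)
  next
    case (step c g z)
    then obtain x y where g: "g = brk x y" "x \<in> I" "y \<in> I" by auto
    have "brk (brk s x) y \<in> span ?G" "brk x (brk s y) \<in> span ?G"
      using lie_idealD(3)[OF I s] g by (auto intro!: span_base)
    then have "brk s g \<in> span ?G" by (simp add: g(1) brk_leibniz[of s] span_add)
    then show ?case
      using step by (simp add: brk_add_right brk_scale_right span_add span_scale)
  qed
  ultimately show ?thesis by (auto simp: lie_ideal_def)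
qed

lemma lie_ideal_derived_series: "lie_ideal I S \<Longrightarrow> lie_ideal (derived_series I n) S"
  by (induction n) (auto intro: lie_ideal_span_brk)

text \<open>If a term of the derived series of a solvable ideal is followed by zero, it is abelian,
  and it is again an ideal of \<open>S\<close>, hence zero. Descending along the series reaches the
  ideal itself.\<close>

lemma semisimple_if_no_abelian_ideal:
  assumes "\<And>A. lie_ideal A S \<Longrightarrow> (\<And>x y. x \<in> A \<Longrightarrow> y \<in> A \<Longrightarrow> brk x y = 0) \<Longrightarrow> A = {0}"
  shows "semisimple S"
  unfolding semisimple_def
proof (intro allI impI, elim conjE)
  fix I assume I: "lie_ideal I S" and "solvable I"
  then obtain n where "derived_series I n = {0}" by (auto simp: solvable_def)
  then show "I = {0}"
  proof (induction n)
    case (Suc n)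
    have "brk x y = 0" if "x \<in> derived_series I n" "y \<in> derived_series I n" for x y
      using Suc.prems span_base[of "brk x y" "{brk x y | x y. x \<in> derived_series I n \<and> y \<in> derived_series I n}"] that
      by auto
    with assms lie_ideal_derived_series[OF I] Suc.IH show ?case by blast
  qed simp
qed

section \<open>Traces on subspaces\<close>

lemma finite_basis_exists:
  assumes "finite F" "S \<subseteq> span F" "subspace S"
  obtains C where "independent C" "finite C" "span C = S"
proof -
  obtain C where C: "C \<subseteq> S" "independent C" "S \<subseteq> span C"
    by (rule maximal_independent_subset)
  then have "finite C" using independent_span_bound[of F C] assms by blast
  with C span_minimal[OF C(1) assms(3)] show ?thesis by (intro that) auto
qed

text \<open>Extend a basis \<open>C\<close> of \<open>I\<close> to a basis \<open>B\<close> of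
  \<open>S\<close>. All values of \<open>f\<close> on \<open>S\<close> lie in \<open>I\<close>, so
  their coordinates at \<open>B - C\<close> vanish and only \<open>C\<close> contributes to the
  diagonal sum.\<close>

lemma trace_on_restrict:
  assumes F: "finite F" "S \<subseteq> span F" and S: "subspace S" and I: "subspace I" "I \<subseteq> S"
    and into: "\<And>x. x \<in> S \<Longrightarrow> f x \<in> I"
    and add: "\<And>x y. f (x + y) = f x + f y"
    and scl: "\<And>c x. f (scale c x) = scale c (f x)"
  shows "trace_on S f = trace_on I f"
proof -
  obtain C where C: "independent C" "finite C" "span C = I"
    using finite_basis_exists[of F I] F I by blast
  have CS: "C \<subseteq> S" using C I span_superset by blast
  obtain B where B: "C \<subseteq> B" "B \<subseteq> S" "independent B" "S \<subseteq> span B"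
    using maximal_independent_subset_extend[OF CS C(1)] by blast
  have fB: "finite B" using independent_span_bound[of F B] B F by blast
  have spB: "span B = S" using B span_minimal[OF B(2) S] by auto
  have rep: "representation B (f b) = representation C (f b)" if "b \<in> B" for b
    by (rule representation_extend) (use B C into that in auto)
  have "trace_on S f = (\<Sum>b\<in>B. representation B (f b) b)"
    by (rule trace_on_eq) (use B fB spB into I add scl in auto)
  also have "\<dots> = (\<Sum>b\<in>B. representation C (f b) b)"
    by (rule sum.cong) (simp_all add: rep)
  also have "\<dots> = (\<Sum>b\<in>C. representation C (f b) b)"
    using B(1) fB representation_ne_zero by (intro sum.mono_neutral_right) blast+
  also have "\<dots> = trace_on I f"
    by (rule trace_on_eq[symmetric]) (use C into I add scl in auto)
  finally show ?thesis .
qed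

text \<open>This is the case of a square-zero map needed for abelian ideals: the trace reduces to
  \<open>I\<close>, where \<open>f\<close> is zero.\<close>

lemma trace_on_eq_0:
  assumes F: "finite F" "S \<subseteq> span F" and S: "subspace S" and I: "subspace I" "I \<subseteq> S"
    and into: "\<And>x. x \<in> S \<Longrightarrow> f x \<in> I" and zero: "\<And>x. x \<in> I \<Longrightarrow> f x = 0"
    and add: "\<And>x y. f (x + y) = f x + f y"
    and scl: "\<And>c x. f (scale c x) = scale c (f x)"
  shows "trace_on S f = 0"
proof -
  obtain C where C: "independent C" "finite C" "span C = I"
    using finite_basis_exists[of F I] F I by blast
  have "trace_on S f = trace_on I f" by (rule trace_on_restrict[OF F S I into add scl])
  also have "\<dots> = (\<Sum>b\<in>C. representation C (f b) b)"
    by (rule trace_on_eq) (use C into I add scl in auto)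
  also have "\<dots> = 0"
    using C zero span_base by (intro sum.neutral) (auto simp: representation_zero)
  finally show ?thesis .
qed

text \<open>In a fixed basis the trace of a composition is a double sum of products of matrix
  entries; exchanging the two sums exchanges the two maps.\<close>

lemma trace_on_comp_commute:
  assumes F: "finite F" "span F = UNIV"
    and f: "Vector_Spaces.linear scale scale f" and g: "Vector_Spaces.linear scale scale g"
  shows "trace_on UNIV (\<lambda>x. f (g x)) = trace_on UNIV (\<lambda>x. g (f x))"
proof -
  obtain B where B: "independent B" "finite B" "span B = UNIV"
    using finite_basis_exists[of F UNIV] F by auto
  have tr: "trace_on UNIV (\<lambda>x. f (g x)) =
      (\<Sum>b\<in>B. \<Sum>c\<in>B. representation B (g b) c * representation B (f c) b)"
    if f: "Vector_Spaces.linear scale scale f" and g: "Vector_Spaces.linear scale scale g" for f g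
  proof -
    interpret f: Vector_Spaces.linear scale scale f by (rule f)
    interpret g: Vector_Spaces.linear scale scale g by (rule g)
    have "trace_on UNIV (\<lambda>x. f (g x)) = (\<Sum>b\<in>B. representation B (f (g b)) b)"
      by (rule trace_on_eq) (use B in \<open>auto simp: f.add g.add f.scale g.scale\<close>)
    also have "\<dots> = (\<Sum>b\<in>B. \<Sum>c\<in>B. representation B (g b) c * representation B (f c) b)"
    proof (rule sum.cong[OF refl])
      fix b
      have "g b = (\<Sum>c\<in>B. scale (representation B (g b) c) c)"
        using sum_representation_eq[of B "g b" B] B by simp
      then have "f (g b) = (\<Sum>c\<in>B. scale (representation B (g b) c) (f c))"
        by (metis (no_types, lifting) f.sum f.scale sum.cong)
      then show "representation B (f (g b)) b =
          (\<Sum>c\<in>B. representation B (g b) c * representation B (f c) b)"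
        using B by (simp add: representation_sum representation_scale)
    qed
    finally show ?thesis .
  qed
  show ?thesis
    unfolding tr[OF f g] tr[OF g f] by (subst sum.swap) (simp add: mult.commute)
qed

lemma trace_on_add:
  assumes F: "finite F" "span F = UNIV"
    and f: "Vector_Spaces.linear scale scale f" and g: "Vector_Spaces.linear scale scale g"
  shows "trace_on UNIV (\<lambda>x. f x + g x) = trace_on UNIV f + trace_on UNIV g"
proof -
  obtain B where B: "independent B" "finite B" "span B = UNIV"
    using finite_basis_exists[of F UNIV] F by auto
  have tr: "trace_on UNIV h = (\<Sum>b\<in>B. representation B (h b) b)"
    if "Vector_Spaces.linear scale scale h" for h
    by (rule trace_on_eq) (use B that in \<open>auto simp: Vector_Spaces.linear_iff\<close>)
  have "Vector_Spaces.linear scale scale (\<lambda>x. f x + g x)"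
    using f g by (auto simp: Vector_Spaces.linear_iff scale_right_distrib)
  then show ?thesis
    using B by (simp add: tr f g representation_add sum.distrib)
qed

lemma trace_on_scale:
  assumes F: "finite F" "span F = UNIV" and f: "Vector_Spaces.linear scale scale f"
  shows "trace_on UNIV (\<lambda>x. scale c (f x)) = c * trace_on UNIV f"
proof -
  obtain B where B: "independent B" "finite B" "span B = UNIV"
    using finite_basis_exists[of F UNIV] F by auto
  have tr: "trace_on UNIV h = (\<Sum>b\<in>B. representation B (h b) b)"
    if "Vector_Spaces.linear scale scale h" for h
    by (rule trace_on_eq) (use B that in \<open>auto simp: Vector_Spaces.linear_iff\<close>)
  have "Vector_Spaces.linear scale scale (\<lambda>x. scale c (f x))"
    using f by (auto simp: Vector_Spaces.linear_iff scale_right_distrib mult.commute)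
  then show ?thesis
    using B by (simp add: tr f representation_scale sum_distrib_left)
qed

section \<open>The Killing form\<close>

lemma linear_brk_brk: "Vector_Spaces.linear scale scale (\<lambda>z. brk x (brk y z))"
  by (simp add: Vector_Spaces.linear_iff vector_space_axioms brk_add_right brk_scale_right)

lemma killing_zero_left: "killing S 0 y = 0"
  by (simp add: killing_def trace_on_def brk_zero_left representation_zero Let_def)

text \<open>For \<open>x\<close> in \<open>I\<close> the map ad x ad y sends \<open>S\<close> into
  \<open>I\<close>, so its trace can be taken on \<open>I\<close>. The element \<open>y\<close> may
  lie outside \<open>I\<close>; \<open>killing I x y\<close> is then just the trace of this map on
  \<open>I\<close>.\<close>

lemma killing_ideal:
  assumes F: "finite F" "S \<subseteq> span F" and S: "subspace S" and I: "lie_ideal I S"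
    and x: "x \<in> I" and y: "y \<in> S" and closed: "\<And>z. z \<in> S \<Longrightarrow> brk y z \<in> S"
  shows "killing S x y = killing I x y"
  unfolding killing_def
  by (rule trace_on_restrict[OF F S])
    (use lie_idealD[OF I] lie_ideal_brk_left[OF I x] closed y in
      \<open>auto simp: brk_add_right brk_scale_right\<close>)

text \<open>The map ad x ad y sends \<open>S\<close> into \<open>I\<close>; on \<open>I\<close> it
  vanishes, because ad y preserves \<open>I\<close> and \<open>x\<close> commutes with
  \<open>I\<close>.\<close>

lemma killing_abelian_ideal_eq_0:
  assumes F: "finite F" "S \<subseteq> span F" and S: "subspace S" and I: "lie_ideal I S"
    and abelian: "\<And>x y. x \<in> I \<Longrightarrow> y \<in> I \<Longrightarrow> brk x y = 0"
    and x: "x \<in> I" and y: "y \<in> S" and closed: "\<And>z. z \<in> S \<Longrightarrow> brk y z \<in> S"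
  shows "killing S x y = 0"
  unfolding killing_def
  by (rule trace_on_eq_0[OF F S lie_idealD(2,1)[OF I]])
    (use lie_idealD[OF I] lie_ideal_brk_left[OF I x] closed x y abelian in
      \<open>auto simp: brk_add_right brk_scale_right\<close>)

text \<open>Writing ad [x,y] and ad [y,z] as commutators, both sides become differences of traces of
  triple products, which agree by cyclicity.\<close>

lemma killing_invariant:
  assumes F: "finite F" "span F = UNIV"
  shows "killing UNIV (brk x y) z = killing UNIV x (brk y z)"
proof -
  have lin: "Vector_Spaces.linear scale scale (\<lambda>w. brk a (brk b (brk c w)))" for a b c
    by (simp add: Vector_Spaces.linear_iff vector_space_axioms brk_add_right brk_scale_right)
  have "killing UNIV (brk x y) z + trace_on UNIV (\<lambda>w. brk y (brk x (brk z w))) =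
      trace_on UNIV (\<lambda>w. brk x (brk y (brk z w)))"
    unfolding killing_def trace_on_add[OF F linear_brk_brk lin, symmetric]
    by (simp add: brk_leibniz[of x y])
  also have "\<dots> = killing UNIV x (brk y z) + trace_on UNIV (\<lambda>w. brk x (brk z (brk y w)))"
    unfolding killing_def trace_on_add[OF F linear_brk_brk lin, symmetric]
    by (simp add: brk_leibniz[of y z] brk_add_right)
  \<comment> \<open>Cyclicity moves ad y from the right end to the left end of the product, giving
    the term that cancels.\<close>
  also have "trace_on UNIV (\<lambda>w. brk x (brk z (brk y w))) =
      trace_on UNIV (\<lambda>w. brk y (brk x (brk z w)))"
    by (rule trace_on_comp_commute[OF F linear_brk_brk brk_linear_right])
  finally show ?thesis by simp
qed

lemma killing_add_left:
  assumes F: "finite F" "span F = UNIV"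
  shows "killing UNIV (x + y) z = killing UNIV x z + killing UNIV y z"
  unfolding killing_def trace_on_add[OF F linear_brk_brk linear_brk_brk, symmetric]
  by (simp add: brk_add_left)

lemma killing_scale_left:
  assumes F: "finite F" "span F = UNIV"
  shows "killing UNIV (scale c x) z = c * killing UNIV x z"
  unfolding killing_def trace_on_scale[OF F linear_brk_brk, symmetric]
  by (simp add: brk_scale_left)

end

context self_dual_lie_algebra
begin

section \<open>The invariant form and orthogonal complements of ideals\<close>

lemma form_add_left: "\<Omega> (x + y) z = \<Omega> x z + \<Omega> y z"
  using form_linear_left[of z] by (simp add: Vector_Spaces.linear_iff)

lemma form_scale_left: "\<Omega> (scale c x) z = c * \<Omega> x z"
  using form_linear_left[of z] by (simp add: Vector_Spaces.linear_iff)

lemma form_zero_left: "\<Omega> 0 z = 0"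
  using form_scale_left[of 0 0 z] by simp

lemma form_zero_right: "\<Omega> z 0 = 0"
  by (metis form_sym form_zero_left)

lemma form_minus_left: "\<Omega> (- x) z = - \<Omega> x z"
  using form_add_left[of x "- x" z] by (simp add: form_zero_left eq_neg_iff_add_eq_0 add.commute)

definition orth_compl :: "'v set \<Rightarrow> 'v set" where
  "orth_compl I = {v. \<forall>w\<in>I. \<Omega> v w = 0}"

lemma lie_ideal_orth_compl:
  assumes I: "lie_ideal I UNIV"
  shows "lie_ideal (orth_compl I) UNIV"
  unfolding lie_ideal_def
proof (intro conjI ballI)
  show "subspace (orth_compl I)"
    by (auto simp: subspace_def orth_compl_def form_zero_left form_add_left form_scale_left)
  fix x y assume "y \<in> orth_compl I"
  then show "brk x y \<in> orth_compl I"
    using lie_idealD(3)[OF I]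
    by (subst brk_anticomm) (simp add: orth_compl_def form_minus_left form_invariant)
qed simp

text \<open>Invariance rewrites \<open>\<Omega> (brk x y) z\<close> as
  \<open>\<Omega> x (brk y z)\<close>, which vanishes for every \<open>z\<close> because
  \<open>brk y z\<close> lies in \<open>I\<close>; nondegeneracy finishes.\<close>

lemma brk_orth_compl_eq_0:
  assumes I: "lie_ideal I UNIV" and x: "x \<in> orth_compl I" and y: "y \<in> I"
  shows "brk x y = 0"
proof (rule form_nondegenerate, rule allI)
  fix z
  have "brk y z \<in> I" by (rule lie_ideal_brk_left[OF I y]) simp
  with x show "\<Omega> (brk x y) z = 0" by (simp add: form_invariant orth_compl_def)
qed

text \<open>A linear map \<open>T\<close> into \<open>I\<close> that vanishes only on vectors of the
  complement replaces the orthogonal projection: by \<open>disj\<close> it is injective on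
  \<open>I\<close>, hence maps \<open>I\<close> onto \<open>I\<close>, and any \<open>v\<close>
  differs from some \<open>x\<close> in \<open>I\<close> by a vector that \<open>T\<close>
  kills.\<close>

lemma orth_compl_decomposition:
  assumes I: "subspace I" and disj: "I \<inter> orth_compl I = {0}"
  shows "\<exists>x\<in>I. \<exists>y\<in>orth_compl I. v = x + y"
proof -
  obtain F where F: "finite F" "span F = UNIV" using finite_dimensional by auto
  obtain C where C: "independent C" "finite C" "span C = I"
    using finite_basis_exists[of F I] F I by auto
  obtain B where B: "independent B" "finite B" "span B = UNIV"
    using finite_basis_exists[of F UNIV] F by auto
  interpret fd: finite_dimensional_vector_space scale B
    by unfold_locales (use B in auto)
  \<comment> \<open>The coefficients of \<open>T u\<close> are the pairings of \<open>u\<close> with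
    the basis \<open>C\<close> of \<open>I\<close>, so \<open>T u = 0\<close> forces
    \<open>u\<close> to be orthogonal to \<open>I\<close>.\<close>
  define T where "T u = (\<Sum>c\<in>C. scale (\<Omega> u c) c)" for u
  interpret T: Vector_Spaces.linear scale scale T
    by (simp add: Vector_Spaces.linear_iff vector_space_axioms T_def form_add_left form_scale_left
        scale_left_distrib sum.distrib scale_sum_right)
  have T_in: "T u \<in> I" for u
    unfolding T_def C(3)[symmetric] by (intro span_sum span_scale span_base)
  have T_0: "u \<in> orth_compl I" if "T u = 0" for u
  proof -
    have c: "\<Omega> u c = 0" if "c \<in> C" for c
      using C(1,2) \<open>T u = 0\<close> that unfolding T_def dependent_finite[OF C(2)] by blast
    have "\<Omega> u w = 0" if "w \<in> span C" for w
      using that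
    proof (induction w rule: span_induct_alt)
      case (step a x y)
      then show ?case
        using c by (metis form_add_left form_scale_left form_sym add_0 mult_zero_right)
    qed (rule form_zero_right)
    then show ?thesis by (simp add: orth_compl_def C)
  qed
  have "inj_on T I"
  proof (rule inj_onI)
    fix x y assume xy: "x \<in> I" "y \<in> I" "T x = T y"
    then have "x - y \<in> orth_compl I" by (intro T_0) (simp add: T.diff)
    then have "x - y \<in> {0}" using xy subspace_diff[OF I] unfolding disj[symmetric] by blast
    then show "x = y" by simp
  qed
  then have inj: "inj_on T (span C)" by (simp add: C)
  \<comment> \<open>The image of \<open>C\<close> consists of as many independent vectors of
    \<open>I\<close> as the dimension of \<open>I\<close>, so it spans \<open>I\<close>.\<close>
  have "independent (T ` C)" using T.independent_injective_image[OF C(1) inj] .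
  moreover have "card (T ` C) = card C"
    using inj span_superset by (intro card_image) (rule inj_on_subset)
  moreover have "T ` C \<subseteq> I" using T_in by auto
  moreover have "dim I = card C"
    using C(1) by (simp add: C(3)[symmetric] dim_eq_card_independent)
  ultimately have "I \<subseteq> span (T ` C)"
    using fd.card_eq_dim[of "T ` C" I] C(2) by auto
  then have "T v \<in> T ` I"
    using T_in[of v] T.span_image[of C] C by auto
  then obtain x where x: "x \<in> I" "T v = T x" by auto
  then have "v - x \<in> orth_compl I" by (intro T_0) (simp add: T.diff)
  with x show ?thesis by (intro bexI[of _ x] bexI[of _ "v - x"]) auto
qed

section \<open>The radical of the shifted form and its complement\<close>

lemma lie_ideal_shifted_radical: "lie_ideal (shifted_radical t UNIV) UNIV"
  unfolding lie_ideal_def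
proof (intro conjI ballI)
  obtain F where F: "finite F" "span F = UNIV" using finite_dimensional by auto
  note k = killing_add_left[OF F] killing_scale_left[OF F] killing_invariant[OF F]
  show sub: "subspace (shifted_radical t UNIV)"
    \<comment> \<open>This instance of homogeneity says that the Killing form vanishes at a zero
      first argument, as membership of 0 requires.\<close>
    using k(2)[of 0 0]
    by (auto simp: subspace_def shifted_radical_def shifted_form_def form_zero_left form_add_left
        form_scale_left k algebra_simps)
  fix x y assume "y \<in> shifted_radical t UNIV"
  \<comment> \<open>Both \<Omega> and \<kappa> are invariant, so pairing \<open>brk y x\<close> with
    \<open>w\<close> amounts to pairing \<open>y\<close> with \<open>brk x w\<close>, which gives
    0.\<close>
  then have "brk y x \<in> shifted_radical t UNIV"
    by (auto simp: shifted_radical_def shifted_form_def form_invariant k)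
  then show "brk x y \<in> shifted_radical t UNIV"
    by (subst brk_anticomm) (rule subspace_neg[OF sub])
qed simp

lemma shifted_radical_iff:
  "x \<in> shifted_radical t S \<longleftrightarrow> x \<in> S \<and> (\<forall>y\<in>S. \<Omega> x y = t * killing S x y)"
  by (auto simp: shifted_radical_def shifted_form_def)

lemma shifted_radical_form:
  "x \<in> shifted_radical t S \<Longrightarrow> y \<in> S \<Longrightarrow> \<Omega> x y = t * killing S x y"
  using shifted_radical_iff by blast

lemma shifted_radical_subset: "shifted_radical t S \<subseteq> S"
  using shifted_radical_iff by blast

lemma abelian_ideal_in_shifted_radical:
  assumes A: "lie_ideal A UNIV" "A \<subseteq> shifted_radical t UNIV"
    and abelian: "\<And>x y. x \<in> A \<Longrightarrow> y \<in> A \<Longrightarrow> brk x y = 0"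
  shows "A = {0}"
proof -
  obtain F where F: "finite F" "span F = UNIV" using finite_dimensional by auto
  have "x = 0" if x: "x \<in> A" for x
  proof (rule form_nondegenerate, rule allI)
    fix y
    have "killing UNIV x y = 0"
      by (rule killing_abelian_ideal_eq_0[of F _ A]) (use F A abelian x in auto)
    moreover have "x \<in> shifted_radical t UNIV" using A x by blast
    ultimately show "\<Omega> x y = 0" by (simp add: shifted_radical_form)
  qed
  moreover have "0 \<in> A" using lie_idealD(2)[OF A(1)] by (rule subspace_0)
  ultimately show ?thesis by auto
qed

text \<open>This is nondegeneracy of \<Omega> on the radical, which nondegeneracy on the whole
  algebra does not give by itself. The intersection is an abelian ideal, because the radical
  commutes with its complement.\<close>

lemma shifted_radical_Int_orth_compl:
  "shifted_radical t UNIV \<inter> orth_compl (shifted_radical t UNIV) = {0}"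
proof (rule abelian_ideal_in_shifted_radical[of _ t])
  note P = lie_ideal_shifted_radical[of t]
  show "lie_ideal (shifted_radical t UNIV \<inter> orth_compl (shifted_radical t UNIV)) UNIV"
    by (intro lie_ideal_Int lie_ideal_orth_compl P)
  show "brk x y = 0"
    if "x \<in> shifted_radical t UNIV \<inter> orth_compl (shifted_radical t UNIV)"
      and "y \<in> shifted_radical t UNIV \<inter> orth_compl (shifted_radical t UNIV)" for x y
    using that by (intro brk_orth_compl_eq_0[OF P]) auto
qed simp

lemma semisimple_shifted_radical: "semisimple (shifted_radical t UNIV)" (is "semisimple ?P")
proof (rule semisimple_if_no_abelian_ideal)
  fix A assume A: "lie_ideal A ?P" and abelian: "\<And>x y. x \<in> A \<Longrightarrow> y \<in> A \<Longrightarrow> brk x y = 0"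
  obtain F where F: "finite F" "span F = UNIV" using finite_dimensional by auto
  note P = lie_ideal_shifted_radical[of t]
  have "x \<in> orth_compl ?P" if x: "x \<in> A" for x
    unfolding orth_compl_def
  proof (intro CollectI ballI)
    fix y assume y: "y \<in> ?P"
    have xP: "x \<in> ?P" using x lie_idealD(1)[OF A] by auto
    \<comment> \<open>\<open>A\<close> is only known to be an ideal of \<open>?P\<close>, so the
      Killing form is first replaced by the intrinsic one of \<open>?P\<close>, where the vanishing
      for abelian ideals applies.\<close>
    have "killing UNIV x y = killing ?P x y"
      by (rule killing_ideal[OF F(1) _ _ P xP]) (simp_all add: F)
    also have "\<dots> = 0"
      by (rule killing_abelian_ideal_eq_0[OF F(1) _ lie_idealD(2)[OF P] A abelian x y])
        (use F lie_idealD(3)[OF P] in auto)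
    finally show "\<Omega> x y = 0" using xP by (simp add: shifted_radical_form)
  qed
  then have "A \<subseteq> {0}"
    using lie_idealD(1)[OF A] shifted_radical_Int_orth_compl by blast
  then show "A = {0}" using subspace_0[OF lie_idealD(2)[OF A]] by auto
qed

text \<open>A vector of the radical on \<open>?Q\<close> pairs with any \<open>w = p + q\<close> as
  it pairs with \<open>q\<close>, under \<Omega> and under \<kappa> alike, so it lies in the radical
  of the whole algebra and hence in the zero intersection.\<close>

lemma shifted_radical_orth_compl_eq_0:
  "shifted_radical t (orth_compl (shifted_radical t UNIV)) = {0}"
  (is "shifted_radical t ?Q = _")
proof -
  let ?P = "shifted_radical t UNIV"
  obtain F where F: "finite F" "span F = UNIV" using finite_dimensional by auto
  note P = lie_ideal_shifted_radical[of t]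
  note Q = lie_ideal_orth_compl[OF P]
  have "x \<in> ?P" if x: "x \<in> shifted_radical t ?Q" for x
    unfolding shifted_radical_iff[of x t UNIV]
  proof (intro conjI ballI UNIV_I)
    fix w
    obtain p q where pq: "p \<in> ?P" "q \<in> ?Q" "w = p + q"
      using orth_compl_decomposition[OF lie_idealD(2)[OF P] shifted_radical_Int_orth_compl] by blast
    have xQ: "x \<in> ?Q" using x shifted_radical_subset by blast
    have brk0: "brk x y = 0" if "y \<in> ?P" for y using brk_orth_compl_eq_0[OF P xQ that] .
    \<comment> \<open>The component \<open>p\<close> drops out: \<open>brk p z\<close> lies in the
      ideal \<open>?P\<close>, which commutes with \<open>x\<close>.\<close>
    have "brk x (brk w z) = brk x (brk q z)" for z
      using brk0[OF lie_ideal_brk_left[OF P pq(1), of z]]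
      by (simp add: pq(3) brk_add_left brk_add_right)
    then have "killing UNIV x w = killing UNIV x q" by (simp add: killing_def)
    also have "\<dots> = killing ?Q x q"
      by (rule killing_ideal[OF F(1) _ _ Q xQ]) (simp_all add: F)
    finally have "killing UNIV x w = killing ?Q x q" .
    moreover have "\<Omega> x w = \<Omega> x q"
    proof -
      have "\<Omega> p x = 0" using xQ pq(1) unfolding orth_compl_def by (subst form_sym) blast
      then show ?thesis
        using form_sym[of x w] form_sym[of x q] by (simp add: pq(3) form_add_left)
    qed
    ultimately show "\<Omega> x w = t * killing UNIV x w"
      using shifted_radical_form[OF x pq(2)] by simp
  qed
  then have "shifted_radical t ?Q \<subseteq> {0}"
    using shifted_radical_Int_orth_compl[of t] shifted_radical_subset[of t ?Q] by blast
  moreover have "0 \<in> shifted_radical t ?Q"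
    using subspace_0[OF lie_idealD(2)[OF Q]]
    by (simp add: shifted_radical_iff[of 0 t ?Q] form_zero_left killing_zero_left)
  ultimately show ?thesis by blast
qed

theorem shifted_radical_direct_factor:
  "semisimple (shifted_radical t UNIV) \<and>
   (\<exists>I. direct_product_of_ideals (shifted_radical t UNIV) I \<and>
        orthogonal (shifted_radical t UNIV) I \<and> shifted_radical t I = {0})"
proof (intro conjI exI)
  let ?P = "shifted_radical t UNIV"
  note P = lie_ideal_shifted_radical[of t]
  show "direct_product_of_ideals ?P (orth_compl ?P)"
    using P lie_ideal_orth_compl[OF P] shifted_radical_Int_orth_compl
      orth_compl_decomposition[OF lie_idealD(2)[OF P] shifted_radical_Int_orth_compl]
    by (auto simp: direct_product_of_ideals_def)
  show "orthogonal ?P (orth_compl ?P)"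
    unfolding orthogonal_def orth_compl_def using form_sym by auto
qed (rule semisimple_shifted_radical, rule shifted_radical_orth_compl_eq_0)

end

text \<open>The real and the complex case are two instances of the locale theorem, which is proved
  over an arbitrary field with the \<Omega>-orthogonal complement as second factor.\<close>

theorem corollary6p3:
  fixes scaleR' :: "real \<Rightarrow> 'v::ab_group_add \<Rightarrow> 'v"
    and brkR :: "'v \<Rightarrow> 'v \<Rightarrow> 'v" and \<Omega>R :: "'v \<Rightarrow> 'v \<Rightarrow> real" and tR :: real
    and scaleC' :: "complex \<Rightarrow> 'w::ab_group_add \<Rightarrow> 'w"
    and brkC :: "'w \<Rightarrow> 'w \<Rightarrow> 'w" and \<Omega>C :: "'w \<Rightarrow> 'w \<Rightarrow> complex" and tC :: complex
  shows
    "(self_dual_lie_algebra scaleR' brkR \<Omega>R \<longrightarrow>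
       (let perp = self_dual_lie_algebra.shifted_radical scaleR' brkR \<Omega>R tR;
            d_perp = perp UNIV
        in lie_algebra.semisimple scaleR' brkR d_perp \<and>
           (\<exists>d1. lie_algebra.direct_product_of_ideals scaleR' brkR d_perp d1 \<and>
                 self_dual_lie_algebra.orthogonal \<Omega>R d_perp d1 \<and>
                 perp d1 = {0}))) \<and>
     (self_dual_lie_algebra scaleC' brkC \<Omega>C \<longrightarrow>
       (let perp = self_dual_lie_algebra.shifted_radical scaleC' brkC \<Omega>C tC;
            d_perp = perp UNIV
        in lie_algebra.semisimple scaleC' brkC d_perp \<and>
           (\<exists>d1. lie_algebra.direct_product_of_ideals scaleC' brkC d_perp d1 \<and>
                 self_dual_lie_algebra.orthogonal \<Omega>C d_perp d1 \<and>
                 perp d1 = {0})))"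
  unfolding Let_def
  by (rule conjI; rule impI; erule self_dual_lie_algebra.shifted_radical_direct_factor)

end
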